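(* Let $A\in\mathbb{R}^{m\times n}$, $m\ge n$, have smallest singular value $\sigma_{\min}$, let $[a,b]\subset[\sigma_{\min},\|A\|]$ with $0<a<b$, and let $\eta\ge\|A\|$ and $0\le\eta_-\le\sigma_{\min}$ with $\eta_-<\eta$. Define $$\hat l(x)=\frac{2x-\eta^2-\eta_-^2}{\eta^2-\eta_-^2}\ \text{ for } x\in[\sigma_{\min}^2,\|A\|^2],\qquad \tilde l(x)=\frac{x}{\eta}\ \text{ for } x\in[-\|A\|,\|A\|],$$ and for each singular value $\sigma$ of $A$ define $$\hat\Delta_{\sigma,a}=|\arccos(\hat l(\sigma^2))-\arccos(\hat l(a^2))|,\qquad \hat\Delta_{\sigma,b}=|\arccos(\hat l(\sigma^2))-\arccos(\hat l(b^2))|,$$ $$\tilde\Delta_{\sigma,a}=|\arccos(\tilde l(\sigma))-\arccos(\tilde l(a))|,\qquad \tilde\Delta_{\sigma,b}=|\arccos(\tilde l(\sigma))-\arccos(\tilde l(b))|.$$ Then for each singular value $\sigma$ of $A$, $$\hat\Delta_{\sigma,a}\ge2\tilde\Delta_{\sigma,a}\quad\text{and}\quad\hat\Delta_{\sigma,b}\ge2\tilde\Delta_{\sigma,b}.$$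
   Context: $\|\cdot\|$ is the 2-norm. *)

theory Defs
  imports "HOL-Analysis.Analysis"
begin

definition eigenvalue :: "real ^ 'n ^ 'n \<Rightarrow> real \<Rightarrow> bool" where
  "eigenvalue M l \<longleftrightarrow> (\<exists>v. v \<noteq> 0 \<and> M *v v = l *\<^sub>R v)"

(* The set of singular values of a matrix with at least as many rows as columns: the square
   roots of the eigenvalues of the (positive semidefinite) Gram matrix, 0 being included
   exactly when A has a nontrivial kernel.  Multiplicities are not recorded. *)
definition singular_values :: "real ^ 'n ^ 'm \<Rightarrow> real set" where
  "singular_values A = {sqrt l | l. eigenvalue (transpose A ** A) l}"

definition sigma_min :: "real ^ 'n ^ 'm \<Rightarrow> real" where
  "sigma_min A = Min (singular_values A)"

(* The operator norm induced by the Euclidean norms; the type class norm of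
   real ^ 'n ^ 'm is the Frobenius norm instead. *)
definition norm2 :: "real ^ 'n ^ 'm \<Rightarrow> real" where
  "norm2 A = onorm (\<lambda>x. A *v x)"

(* The maps l-hat and l-tilde are total here; they are only ever applied at points of
   [sigma_min\<^sup>2, norm2\<^sup>2] and of [-norm2, norm2] respectively.
   The argument eta' stands for the eta with subscript minus. *)
definition l_hat :: "real \<Rightarrow> real \<Rightarrow> real \<Rightarrow> real" where
  "l_hat \<eta> \<eta>' x = (2 * x - \<eta>\<^sup>2 - \<eta>'\<^sup>2) / (\<eta>\<^sup>2 - \<eta>'\<^sup>2)"

definition l_tilde :: "real \<Rightarrow> real \<Rightarrow> real" where
  "l_tilde \<eta> x = x / \<eta>"

definition Delta_hat :: "real \<Rightarrow> real \<Rightarrow> real \<Rightarrow> real \<Rightarrow> real" where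
  "Delta_hat \<eta> \<eta>' \<sigma> c = \<bar>arccos (l_hat \<eta> \<eta>' (\<sigma>\<^sup>2)) - arccos (l_hat \<eta> \<eta>' (c\<^sup>2))\<bar>"

definition Delta_tilde :: "real \<Rightarrow> real \<Rightarrow> real \<Rightarrow> real" where
  "Delta_tilde \<eta> \<sigma> c = \<bar>arccos (l_tilde \<eta> \<sigma>) - arccos (l_tilde \<eta> c)\<bar>"

end

theory Submission
  imports Defs
begin

text \<open>
  Write \<open>\<phi>(c) = arccos (c / \<eta>)\<close> and \<open>\<psi>(c) = arccos (l_hat (c\<^sup>2))\<close>. For \<open>\<eta>' = 0\<close> the formula for
  \<open>l_hat\<close> is the double angle formula for the cosine, so \<open>\<psi> = 2 \<phi>\<close> and both inequalities are
  equalities. For general \<open>\<eta>'\<close> the half angle formula for the sine still relates the two angles: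
  \<open>sin\<^sup>2 (\<psi> / 2) = (1 - l_hat (c\<^sup>2)) / 2 = (\<eta>\<^sup>2 - c\<^sup>2) / (\<eta>\<^sup>2 - \<eta>'\<^sup>2)\<close>, and therefore
  \<open>sin (\<psi> / 2) = k sin \<phi>\<close> with the constant \<open>k = \<eta> / sqrt (\<eta>\<^sup>2 - \<eta>'\<^sup>2) \<ge> 1\<close>
  (lemma \<open>sin_half_arccos_l_hat\<close>). Both \<open>\<phi>\<close> and \<open>\<psi> / 2\<close> lie in \<open>[0, \<pi>/2]\<close>.
  On this interval the map \<open>\<phi> \<mapsto> arcsin (k sin \<phi>)\<close> does not decrease distances, as far as it is
  defined (lemma \<open>sin_scaling_expands\<close>); this is the claim, for arbitrary points of \<open>[\<eta>', \<eta>]\<close>.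

  What remains is that every singular value lies between \<open>\<sigma>\<^sub>m\<^sub>i\<^sub>n\<close> and the operator norm. The lower
  bound holds because the minimum is taken over a finite set: eigenvectors of the symmetric Gram
  matrix for distinct eigenvalues are orthogonal. The upper bound comes from
  \<open>\<parallel>A v\<parallel>\<^sup>2 = l \<parallel>v\<parallel>\<^sup>2\<close> for an eigenvector \<open>v\<close> of the Gram matrix with eigenvalue \<open>l\<close>.
\<close>

lemma gram_inner:
  fixes A :: "real ^ 'n ^ 'm"
  shows "((transpose A ** A) *v v) \<bullet> w = (A *v v) \<bullet> (A *v w)"
  by (metis dot_lmul_matrix inner_commute matrix_vector_mul_assoc vector_transpose_matrix
      transpose_matrix_vector)

text \<open>
  Choosing one eigenvector per eigenvalue is injective, and the chosen vectors are pairwise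
  orthogonal, hence independent; in finite dimension there are only finitely many of them.
\<close>

lemma finite_singular_values:
  fixes A :: "real ^ 'n ^ 'm"
  shows "finite (singular_values A)"
proof -
  define M where "M = transpose A ** A"
  define E where "E = {l. eigenvalue M l}"
  obtain f where f: "f l \<noteq> 0" "M *v f l = l *\<^sub>R f l" if "l \<in> E" for l
  proof -
    have "\<forall>l\<in>E. \<exists>v. v \<noteq> 0 \<and> M *v v = l *\<^sub>R v"
      by (auto simp: E_def eigenvalue_def)
    then show thesis
      using that by metis
  qed
  have orth: "f l \<bullet> f l' = 0" if "l \<in> E" "l' \<in> E" "l \<noteq> l'" for l l'
  proof -
    have "l * (f l \<bullet> f l') = (M *v f l) \<bullet> f l'"
      using f that by simp
    also have "\<dots> = (M *v f l') \<bullet> f l"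
      unfolding M_def gram_inner by (rule inner_commute)
    also have "\<dots> = l' * (f l \<bullet> f l')"
      using f that by (simp add: inner_commute)
    finally show ?thesis
      using that by simp
  qed
  have "inj_on f E"
    by (metis f(1) inj_onI inner_eq_zero_iff orth)
  moreover have "finite (f ` E)"
  proof -
    have "pairwise orthogonal (f ` E)"
      using orth by (auto simp: pairwise_def orthogonal_def)
    moreover have "0 \<notin> f ` E"
      using f(1) by force
    ultimately have "independent (f ` E)"
      by (rule pairwise_orthogonal_independent)
    then show ?thesis
      by (rule independent_imp_finite)
  qed
  ultimately have "finite E"
    using finite_imageD by blast
  moreover have "singular_values A = sqrt ` E"
    by (auto simp: singular_values_def E_def M_def)
  ultimately show ?thesis
    by simp
qed

lemma singular_value_le_norm2:
  fixes A :: "real ^ 'n ^ 'm"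
  assumes "\<sigma> \<in> singular_values A"
  shows "\<sigma> \<le> norm2 A"
proof -
  obtain l v where \<sigma>: "\<sigma> = sqrt l" and "v \<noteq> 0"
    and v: "(transpose A ** A) *v v = l *\<^sub>R v"
    using assms by (auto simp: singular_values_def eigenvalue_def)
  have "l * (norm v)\<^sup>2 = (norm (A *v v))\<^sup>2"
    using gram_inner[of A v v] v by (simp add: power2_norm_eq_inner)
  then have "\<sigma> * norm v = norm (A *v v)"
    unfolding \<sigma> by (metis norm_ge_zero real_sqrt_mult real_sqrt_unique)
  also have "\<dots> \<le> norm2 A * norm v"
    unfolding norm2_def by (rule onorm) (rule matrix_vector_mul_bounded_linear)
  finally show ?thesis
    using \<open>v \<noteq> 0\<close> by simp
qed

text \<open>
  The derivative of \<open>x \<mapsto> arcsin (k sin x)\<close> is at least 1, but it is unbounded near \<open>k sin x = 1\<close>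
  if \<open>k > 1\<close>, so the proof uses the factorisation
  \<open>sin u - sin v = 2 sin ((u - v) / 2) cos ((u + v) / 2)\<close> instead. Let \<open>y < x\<close>. Since
  \<open>u + v \<ge> x + y\<close>, the assumption \<open>u - v < x - y\<close> would make \<open>sin u - sin v\<close> smaller than
  \<open>sin x - sin y\<close>, whereas it is \<open>k\<close> times that number.
\<close>

lemma sin_scaling_expands:
  fixes k x y u v :: real
  assumes k: "1 \<le> k"
    and x: "0 \<le> x" "x \<le> pi / 2" and y: "0 \<le> y" "y \<le> pi / 2"
    and u: "0 \<le> u" "u \<le> pi / 2" and v: "0 \<le> v" "v \<le> pi / 2"
    and su: "sin u = k * sin x" and sv: "sin v = k * sin y"
  shows "\<bar>x - y\<bar> \<le> \<bar>u - v\<bar>"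
proof -
  have ordered: "q - p \<le> s - r"
    if p: "0 \<le> p" and pq: "p \<le> q" and q: "q \<le> pi / 2"
      and r: "0 \<le> r" "r \<le> pi / 2" and s: "0 \<le> s" "s \<le> pi / 2"
      and sr: "sin r = k * sin p" and ss: "sin s = k * sin q" for p q r s
  proof (rule ccontr)
    assume "\<not> q - p \<le> s - r"
    then have less: "s - r < q - p" by simp
    have sin_pq: "0 \<le> sin p" "sin p \<le> sin q"
      using p pq q by (auto intro!: sin_ge_zero simp: sin_mono_le_eq)
    have "sin p \<le> sin r" "sin q \<le> sin s" "sin r \<le> sin s"
      using k sin_pq unfolding sr ss
      by (auto intro: mult_left_mono mult_right_mono[of 1 k, simplified])
    then have le: "p \<le> r" "q \<le> s" "r \<le> s"
      using p pq q r s by (auto simp: sin_mono_le_eq)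
    have "sin s - sin r = 2 * sin ((s - r) / 2) * cos ((s + r) / 2)"
      by (rule sin_diff_sin)
    also have "\<dots> \<le> 2 * sin ((s - r) / 2) * cos ((q + p) / 2)"
      using le p pq q r s
      by (intro mult_left_mono) (auto intro!: cos_monotone_0_pi_le sin_ge_zero)
    also have "\<dots> < 2 * sin ((q - p) / 2) * cos ((q + p) / 2)"
    proof -
      have "sin ((s - r) / 2) < sin ((q - p) / 2)"
        using less le p q r s by (intro sin_monotone_2pi) auto
      moreover have "0 < cos ((q + p) / 2)"
        using less le p q by (intro cos_gt_zero_pi) auto
      ultimately show ?thesis by simp
    qed
    also have "\<dots> = sin q - sin p"
      by (rule sin_diff_sin[symmetric])
    also have "\<dots> \<le> k * (sin q - sin p)"
      using k sin_pq by (intro mult_right_mono[of 1 k, simplified]) auto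
    also have "\<dots> = sin s - sin r"
      by (simp add: sr ss right_diff_distrib)
    finally show False by simp
  qed
  show ?thesis
  proof (cases "y \<le> x")
    case True
    then show ?thesis
      using ordered[of y x v u] assms by linarith
  next
    case False
    then show ?thesis
      using ordered[of x y u v] assms by linarith
  qed
qed

lemma l_hat_bounds:
  assumes "0 \<le> \<eta>'" "\<eta>' < \<eta>" "\<eta>' \<le> c" "c \<le> \<eta>"
  shows "-1 \<le> l_hat \<eta> \<eta>' (c\<^sup>2)" "l_hat \<eta> \<eta>' (c\<^sup>2) \<le> 1"
proof -
  have "\<eta>'\<^sup>2 < \<eta>\<^sup>2" "\<eta>'\<^sup>2 \<le> c\<^sup>2" "c\<^sup>2 \<le> \<eta>\<^sup>2"
    using assms by (auto intro: power_strict_mono power_mono)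
  then show "-1 \<le> l_hat \<eta> \<eta>' (c\<^sup>2)" "l_hat \<eta> \<eta>' (c\<^sup>2) \<le> 1"
    by (auto simp: l_hat_def field_simps)
qed

text \<open>The squares of both sides equal \<open>(\<eta>\<^sup>2 - c\<^sup>2) / (\<eta>\<^sup>2 - \<eta>'\<^sup>2)\<close>.\<close>

lemma sin_half_arccos_l_hat:
  assumes "0 \<le> \<eta>'" "\<eta>' < \<eta>" "\<eta>' \<le> c" "c \<le> \<eta>"
  shows "sin (arccos (l_hat \<eta> \<eta>' (c\<^sup>2)) / 2)
       = \<eta> / sqrt (\<eta>\<^sup>2 - \<eta>'\<^sup>2) * sin (arccos (l_tilde \<eta> c))"
proof -
  note l = l_hat_bounds[OF assms]
  have pos: "0 < \<eta>\<^sup>2 - \<eta>'\<^sup>2"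
    using assms by (simp add: power_strict_mono)
  have t: "-1 \<le> l_tilde \<eta> c" "l_tilde \<eta> c \<le> 1"
    using assms by (auto simp: l_tilde_def field_simps)
  have "2 * (sin (arccos (l_hat \<eta> \<eta>' (c\<^sup>2)) / 2))\<^sup>2 = 1 - l_hat \<eta> \<eta>' (c\<^sup>2)"
    using cos_double_sin[of "arccos (l_hat \<eta> \<eta>' (c\<^sup>2)) / 2"] l by simp
  also have "\<dots> = 2 * ((\<eta>\<^sup>2 - c\<^sup>2) / (\<eta>\<^sup>2 - \<eta>'\<^sup>2))"
    using pos by (simp add: l_hat_def field_simps)
  finally have "(sin (arccos (l_hat \<eta> \<eta>' (c\<^sup>2)) / 2))\<^sup>2 = (\<eta>\<^sup>2 - c\<^sup>2) / (\<eta>\<^sup>2 - \<eta>'\<^sup>2)"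
    unfolding mult_cancel_left by simp
  also have "\<dots> = (\<eta> / sqrt (\<eta>\<^sup>2 - \<eta>'\<^sup>2) * sin (arccos (l_tilde \<eta> c)))\<^sup>2"
  proof -
    have "(sin (arccos (l_tilde \<eta> c)))\<^sup>2 = 1 - (c / \<eta>)\<^sup>2"
      using t by (simp add: sin_squared_eq l_tilde_def)
    then show ?thesis
      using pos assms
      by (simp add: power_mult_distrib power_divide right_diff_distrib diff_divide_distrib)
  qed
  finally show ?thesis
  proof (rule power2_eq_imp_eq)
    show "0 \<le> sin (arccos (l_hat \<eta> \<eta>' (c\<^sup>2)) / 2)"
      using arccos_lbound[OF l] arccos_ubound[OF l] by (intro sin_ge_zero) auto
    show "0 \<le> \<eta> / sqrt (\<eta>\<^sup>2 - \<eta>'\<^sup>2) * sin (arccos (l_tilde \<eta> c))"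
      using assms pos arccos_lbound[OF t] arccos_ubound[OF t]
      by (intro mult_nonneg_nonneg sin_ge_zero divide_nonneg_nonneg) auto
  qed
qed

lemma Delta_hat_ge_double_Delta_tilde:
  assumes \<eta>: "0 \<le> \<eta>'" "\<eta>' < \<eta>"
    and s: "\<eta>' \<le> s" "s \<le> \<eta>" and c: "\<eta>' \<le> c" "c \<le> \<eta>"
  shows "2 * Delta_tilde \<eta> s c \<le> Delta_hat \<eta> \<eta>' s c"
proof -
  define k where "k = \<eta> / sqrt (\<eta>\<^sup>2 - \<eta>'\<^sup>2)"
  have k: "1 \<le> k"
  proof -
    have "sqrt (\<eta>\<^sup>2 - \<eta>'\<^sup>2) \<le> sqrt (\<eta>\<^sup>2)"
      by (rule real_sqrt_le_mono) simp
    moreover have "0 < sqrt (\<eta>\<^sup>2 - \<eta>'\<^sup>2)"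
      using \<eta> by (simp add: power_strict_mono)
    ultimately show ?thesis
      using \<eta> by (simp add: k_def)
  qed
  have tilde: "0 \<le> arccos (l_tilde \<eta> z)" "arccos (l_tilde \<eta> z) \<le> pi / 2"
    if "\<eta>' \<le> z" "z \<le> \<eta>" for z
  proof -
    have "0 \<le> l_tilde \<eta> z" "l_tilde \<eta> z \<le> 1"
      using \<eta> that by (auto simp: l_tilde_def)
    then show "0 \<le> arccos (l_tilde \<eta> z)" "arccos (l_tilde \<eta> z) \<le> pi / 2"
      using arccos_lbound[of "l_tilde \<eta> z"] arccos_le_pi2[of "l_tilde \<eta> z"] by auto
  qed
  have hat: "0 \<le> arccos (l_hat \<eta> \<eta>' (z\<^sup>2)) / 2" "arccos (l_hat \<eta> \<eta>' (z\<^sup>2)) / 2 \<le> pi / 2"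
    if "\<eta>' \<le> z" "z \<le> \<eta>" for z
    using arccos_lbound[OF l_hat_bounds[OF \<eta> that]] arccos_ubound[OF l_hat_bounds[OF \<eta> that]]
    by auto
  have "\<bar>arccos (l_tilde \<eta> s) - arccos (l_tilde \<eta> c)\<bar>
      \<le> \<bar>arccos (l_hat \<eta> \<eta>' (s\<^sup>2)) / 2 - arccos (l_hat \<eta> \<eta>' (c\<^sup>2)) / 2\<bar>"
    using sin_scaling_expands[OF k tilde[OF s] tilde[OF c] hat[OF s] hat[OF c]]
      sin_half_arccos_l_hat[OF \<eta> s] sin_half_arccos_l_hat[OF \<eta> c]
    unfolding k_def by blast
  then show ?thesis
    by (simp add: Delta_hat_def Delta_tilde_def flip: diff_divide_distrib)
qed

theorem theorem7p1:
  fixes A :: "real ^ 'n ^ 'm" and a b \<eta> \<eta>' :: real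
  assumes "CARD('n) \<le> CARD('m)"
    and "{a..b} \<subseteq> {sigma_min A..norm2 A}"
    and "0 < a" and "a < b"
    and "norm2 A \<le> \<eta>"
    and "0 \<le> \<eta>'" and "\<eta>' \<le> sigma_min A" and "\<eta>' < \<eta>"
  shows "\<forall>\<sigma> \<in> singular_values A.
      Delta_hat \<eta> \<eta>' \<sigma> a \<ge> 2 * Delta_tilde \<eta> \<sigma> a \<and>
      Delta_hat \<eta> \<eta>' \<sigma> b \<ge> 2 * Delta_tilde \<eta> \<sigma> b"
proof
  fix \<sigma>
  assume \<sigma>: "\<sigma> \<in> singular_values A"
  then have "sigma_min A \<le> \<sigma>"
    unfolding sigma_min_def using finite_singular_values by (intro Min_le)
  moreover have "\<sigma> \<le> norm2 A"
    using \<sigma> by (rule singular_value_le_norm2)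
  moreover have "sigma_min A \<le> a" "b \<le> norm2 A"
    using assms by auto
  ultimately show "Delta_hat \<eta> \<eta>' \<sigma> a \<ge> 2 * Delta_tilde \<eta> \<sigma> a \<and>
      Delta_hat \<eta> \<eta>' \<sigma> b \<ge> 2 * Delta_tilde \<eta> \<sigma> b"
    using assms by (intro conjI Delta_hat_ge_double_Delta_tilde) linarith+
qed

end
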